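(* Every regular scattered $P$-space of weight $\omega_1$ has a scattered compactification of cardinality $\omega_1$.
   Context: A topological space is a $P$-space if all its $G_\delta$ subsets are open; regular spaces are assumed to be $T_1$. A space is scattered if every non-empty subspace of it has an isolated point. A compactification of $X$ is a compact Hausdorff space containing a homeomorphic copy of $X$ as a dense subspace (it is not required to be a $P$-space). *)

theory Defs
  imports "HOL-Analysis.Analysis"
begin

unbundle cardinal_syntax

definition omega1 :: "nat set rel"
  where "omega1 = cardSuc natLeq"

definition P_space :: "'a topology \<Rightarrow> bool"
  where "P_space X \<longleftrightarrow> (\<forall>S. gdelta_in X S \<longrightarrow> openin X S)"

definition scattered_space :: "'a topology \<Rightarrow> bool"
  where "scattered_space X \<longleftrightarrow>
    (\<forall>S. S \<subseteq> topspace X \<and> S \<noteq> {} \<longrightarrow> (\<exists>x\<in>S. openin (subtopology X S) {x}))"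

definition base_of :: "'a topology \<Rightarrow> 'a set set \<Rightarrow> bool"
  where "base_of X \<B> \<longleftrightarrow>
    (\<forall>V\<in>\<B>. openin X V) \<and>
    (\<forall>U x. openin X U \<and> x \<in> U \<longrightarrow> (\<exists>V\<in>\<B>. x \<in> V \<and> V \<subseteq> U))"

text \<open>The weight, i.e. the least cardinality of a base, equals the cardinal \<open>r\<close>.\<close>

definition has_weight :: "'a topology \<Rightarrow> 'c rel \<Rightarrow> bool"
  where "has_weight X r \<longleftrightarrow>
    (\<exists>\<B>. base_of X \<B> \<and> |\<B>| =o r) \<and> (\<forall>\<B>. base_of X \<B> \<longrightarrow> r \<le>o |\<B>| )"

definition compactification_of :: "'b topology \<Rightarrow> 'a topology \<Rightarrow> bool"
  where "compactification_of Y X \<longleftrightarrow>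
    compact_space Y \<and> Hausdorff_space Y \<and>
    (\<exists>D\<subseteq>topspace Y. X homeomorphic_space subtopology Y D \<and> Y closure_of D = topspace Y)"

text \<open>
  HOL cannot quantify existentially over the type carrying a compactification. A statement
  about the existence of a space of cardinality \<open>omega1\<close> loses nothing by placing that space
  on the type \<open>nat set\<close>: this type has a subset of cardinality \<open>omega1\<close> (the field
  of \<open>omega1\<close>), so every such space has a homeomorphic copy there.
\<close>

end

theory Submission
  imports Defs "HOL-Library.Countable_Set_Type"
begin

text \<open>
  A compactification of a zero-dimensional space \<open>X\<close> is obtained by choosing a family \<open>\<B>\<close> of
  clopen sets that generates the topology and closing the image of \<open>X\<close> under
  \<open>x \<mapsto> (\<lambda>B. x \<in> B)\<close> in the Cantor cube over \<open>\<B>\<close>. Its points are the \<^emph>\<open>traces\<close> of \<open>\<B>\<close>: the subsets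
  \<open>t\<close> of \<open>\<B>\<close> such that on each finite part of \<open>\<B>\<close> membership in \<open>t\<close> means containing a certain
  point of \<open>X\<close>. So the task is to choose at most \<open>omega1\<close> clopen sets whose traces form a scattered space. Cardinality then comes for free: a
  scattered space of weight at most \<open>omega1\<close> has at most \<open>omega1\<close> points
  (\<open>card_scattered_sets\<close>), and \<open>X\<close> itself is uncountable because a countable
  \<open>T\<^sub>1\<close> P-space is discrete and so has countable weight (\<open>omega1_le_card_topspace\<close>).

  Call a clopen set tame if it carries such a family. The heart of the proof is that tame sets can
  be glued (\<open>tame_glue\<close>). Let at most \<open>omega1\<close> tame subsets of \<open>U\<close> be given, well-ordered so that
  proper initial segments are countable. In a P-space countable unions of clopen sets are clopen,
  so subtracting from each set \<open>G\<close> the union of its predecessors yields disjoint clopen pieces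
  \<open>D G\<close>, and the initial unions \<open>J G\<close> are clopen as well. Take as new family all pieces, all initial
  unions, and the old families on the pieces. A trace containing a piece lives in the scattered
  trace space of that piece. A trace containing no piece is determined by the first initial union
  that it contains, and in any set of such traces the one whose first initial union comes earliest
  is isolated; only the empty trace contains no initial union. The resulting space resembles a
  well-ordered interval in which the successor points have been replaced by compactifications of
  the pieces.

  Gluing with a cover shows that a locally tame clopen set is tame. Gluing with the complements of
  the clopen neighbourhoods of a single point \<open>p\<close> shows that a clopen set is tame as soon as it is
  locally tame off \<open>p\<close>. Were some point of \<open>X\<close> in no tame set, then scatteredness would provide an
  isolated point of the set of all such points, and a small clopen neighbourhood of it would be
  tame by the second observation. Hence \<open>X\<close> is locally tame, and so tame (\<open>tame_topspace\<close>).
\<close>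

section \<open>The cardinal \<open>omega1\<close>\<close>

lemma Cinfinite_omega1: "Cinfinite omega1"
  unfolding omega1_def by (rule Cinfinite_cardSuc[OF natLeq_Cinfinite])

lemma infinite_Field_omega1: "infinite (Field omega1)"
  using Cinfinite_omega1 unfolding cinfinite_def by blast

lemma Card_order_omega1: "Card_order omega1"
  using Cinfinite_omega1 by blast

lemma countable_iff_ordLess_omega1: "countable A \<longleftrightarrow> |A| <o omega1"
  unfolding omega1_def countable_card_le_natLeq
  using cardSuc_ordLeq_ordLess[OF natLeq_Card_order card_of_Card_order] by blast

lemma countable_imp_ordLeq_omega1: "countable A \<Longrightarrow> |A| \<le>o omega1"
  using countable_iff_ordLess_omega1 ordLess_imp_ordLeq by blast

lemma omega1_le_UNIV_nat_set: "omega1 \<le>o |UNIV :: nat set set|"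
proof -
  have "natLeq <o |Pow (UNIV :: nat set)|"
    using Card_order_Pow[OF natLeq_Card_order] by (simp add: Field_natLeq)
  then show ?thesis
    unfolding omega1_def
    using cardSuc_ordLess_ordLeq[OF natLeq_Card_order card_of_Card_order] by (metis Pow_UNIV)
qed

lemma image_ordLeq_omega1: "|A| \<le>o omega1 \<Longrightarrow> |f ` A| \<le>o omega1"
  using card_of_image ordLeq_transitive by blast

lemma subset_ordLeq_omega1: "B \<subseteq> A \<Longrightarrow> |A| \<le>o omega1 \<Longrightarrow> |B| \<le>o omega1"
  using card_of_mono1 ordLeq_transitive by blast

lemma UNION_ordLeq_omega1:
  "|I| \<le>o omega1 \<Longrightarrow> (\<And>i. i \<in> I \<Longrightarrow> |A i| \<le>o omega1) \<Longrightarrow> |\<Union>i\<in>I. A i| \<le>o omega1"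
  using UNION_Cinfinite_bound[OF _ _ Cinfinite_omega1] by blast

lemma Un_ordLeq_omega1:
  "|A| \<le>o omega1 \<Longrightarrow> |B| \<le>o omega1 \<Longrightarrow> |A \<union> B| \<le>o omega1"
  by (simp add: Un_Cinfinite_bound Cinfinite_omega1)

lemma Times_ordLeq_omega1:
  "|A| \<le>o omega1 \<Longrightarrow> |B| \<le>o omega1 \<Longrightarrow> |A \<times> B| \<le>o omega1"
  by (simp add: card_of_Times_ordLeq_infinite_Field infinite_Field_omega1 Card_order_omega1)

text \<open>
  Finite sets are sorted by cardinality, since those with \<open>n + 1\<close> elements arise from
  those with \<open>n\<close> by inserting one element.
\<close>

lemma Fpow_ordLeq_omega1:
  assumes A: "|A| \<le>o omega1"
  shows "|Fpow A| \<le>o omega1"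
proof -
  define P where "P = (\<lambda>n. {F. F \<subseteq> A \<and> finite F \<and> card F = n})"
  have P: "|P n| \<le>o omega1" for n
  proof (induction n)
    case 0
    have "P 0 = {{}}"
      by (auto simp: P_def)
    then show ?case
      by (simp add: countable_imp_ordLeq_omega1)
  next
    case (Suc n)
    have "P (Suc n) \<subseteq> (\<lambda>(a, F). insert a F) ` (A \<times> P n)"
    proof
      fix F assume "F \<in> P (Suc n)"
      then obtain a where "a \<in> F" "F - {a} \<in> P n" "F \<subseteq> A"
        unfolding P_def by (cases "F = {}") (auto simp: card_Diff_singleton)
      then show "F \<in> (\<lambda>(a, F). insert a F) ` (A \<times> P n)"
        by (intro image_eqI[of _ _ "(a, F - {a})"]) auto
    qed
    then show ?case
      by (rule subset_ordLeq_omega1[OF _ image_ordLeq_omega1[OF Times_ordLeq_omega1[OF A Suc]]])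
  qed
  have "Fpow A \<subseteq> (\<Union>n. P n)"
    by (auto simp: Fpow_def P_def)
  then show ?thesis
    using UNION_ordLeq_omega1[of "UNIV :: nat set" P] P
      subset_ordLeq_omega1 countable_imp_ordLeq_omega1[of "UNIV :: nat set"] by blast
qed

section \<open>Clopen sets in regular P-spaces\<close>

abbreviation clopenin :: "'a topology \<Rightarrow> 'a set \<Rightarrow> bool"
  where "clopenin X S \<equiv> openin X S \<and> closedin X S"

lemma P_space_openin_countable_Inter:
  assumes P: "P_space X" and "countable \<U>" and "\<And>U. U \<in> \<U> \<Longrightarrow> openin X U"
  shows "openin X (topspace X \<inter> \<Inter>\<U>)"
proof -
  have "gdelta_in X (topspace X \<inter> \<Inter>\<U>)"
    using assms unfolding gdelta_in_def relative_to_def intersection_of_def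
    by (metis mem_Collect_eq subsetI)
  then show ?thesis
    using P unfolding P_space_def by blast
qed

lemma P_space_clopenin_countable_Union:
  assumes P: "P_space X" and "countable \<U>" and clo: "\<And>U. U \<in> \<U> \<Longrightarrow> clopenin X U"
  shows "clopenin X (\<Union>\<U>)"
proof
  show "openin X (\<Union>\<U>)"
    using clo by blast
  have "openin X (topspace X \<inter> \<Inter>((\<lambda>U. topspace X - U) ` \<U>))"
    by (rule P_space_openin_countable_Inter[OF P]) (use assms in auto)
  moreover have "topspace X \<inter> \<Inter>((\<lambda>U. topspace X - U) ` \<U>) = topspace X - \<Union>\<U>"
    by auto
  ultimately show "closedin X (\<Union>\<U>)"
    unfolding closedin_def using clo openin_subset by fastforce
qed

text \<open>
  Regularity gives a sequence of open neighbourhoods, each containing the closure of the next.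
  Their intersection is also the intersection of the closures, hence closed, and it is open
  because \<open>X\<close> is a P-space.
\<close>

lemma regular_P_space_clopen_neighbourhood:
  assumes reg: "regular_space X" and P: "P_space X" and "openin X W" "x \<in> W"
  obtains C where "clopenin X C" "x \<in> C" "C \<subseteq> W"
proof -
  let ?N = "\<lambda>U. openin X U \<and> x \<in> U \<and> U \<subseteq> W"
  have step: "\<exists>V. ?N V \<and> X closure_of V \<subseteq> U" if U: "?N U" for U
  proof -
    have xU: "x \<in> topspace X - (topspace X - U)"
      using U openin_subset by fastforce
    have "closedin X (topspace X - U)"
      using U by blast
    then obtain V where V: "openin X V" "x \<in> V" "disjnt (topspace X - U) (X closure_of V)"
      using reg xU unfolding regular_space by meson
    have "X closure_of V \<subseteq> U"
      using V closure_of_subset_topspace[of X V] by (auto simp: disjnt_def)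
    moreover have "V \<subseteq> X closure_of V"
      using V by (simp add: closure_of_subset openin_subset)
    ultimately show ?thesis
      using V U by blast
  qed
  have "\<exists>f. \<forall>n::nat. ?N (f n) \<and> X closure_of (f (Suc n)) \<subseteq> f n"
    by (rule dependent_nat_choice) (use assms(3,4) step in blast)+
  then obtain f :: "nat \<Rightarrow> 'a set"
    where f: "\<And>n. ?N (f n)" "\<And>n. X closure_of (f (Suc n)) \<subseteq> f n"
    by blast
  let ?C = "\<Inter>n. f n"
  have "openin X (topspace X \<inter> \<Inter>(range f))"
    by (rule P_space_openin_countable_Inter[OF P]) (use f in auto)
  moreover have "?C \<subseteq> topspace X"
    using f(1)[of 0] openin_subset by fastforce
  ultimately have "openin X ?C"
    by (simp add: Int_absorb1)
  have "f (Suc n) \<subseteq> X closure_of (f (Suc n))" for n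
    using f(1) by (simp add: closure_of_subset openin_subset)
  then have "?C = (\<Inter>n. X closure_of (f (Suc n)))"
    using f(2) by blast
  then have "closedin X ?C"
    by auto
  show thesis
    by (rule that[of ?C]) (use \<open>openin X ?C\<close> \<open>closedin X ?C\<close> f(1) in auto)
qed

lemma base_of_refine:
  assumes "base_of X \<B>" "openin X U" "x \<in> U"
  shows "\<exists>V\<in>\<B>. x \<in> V \<and> V \<subseteq> U"
  using assms by (simp add: base_of_def)

lemma t1_space_openin_delete_point: "t1_space X \<Longrightarrow> openin X (topspace X - {x})"
  by (metis openin_topspace t1_space_openin_delete_alt)

text \<open>
  Clopen neighbourhoods need not belong to a given base, but one clopen set between any two
  comparable base sets that admit one is enough, and there are only \<open>omega1\<close> pairs of base sets.
\<close>

lemma small_clopen_base: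
  assumes reg: "regular_space X" and P: "P_space X" and w: "has_weight X omega1"
  obtains \<C> where "base_of X \<C>" "|\<C>| \<le>o omega1" "\<And>C. C \<in> \<C> \<Longrightarrow> clopenin X C"
proof -
  obtain \<B> where \<B>: "base_of X \<B>" "|\<B>| =o omega1"
    using w unfolding has_weight_def by blast
  let ?between = "\<lambda>(A, B) C. clopenin X C \<and> A \<subseteq> C \<and> C \<subseteq> B"
  let ?I = "{AB \<in> \<B> \<times> \<B>. \<exists>C. ?between AB C}"
  define c where "c = (\<lambda>AB. SOME C. ?between AB C)"
  have c: "?between AB (c AB)" if "AB \<in> ?I" for AB
    unfolding c_def by (rule someI_ex) (use that in blast)
  have "|?I| \<le>o omega1"
    by (rule subset_ordLeq_omega1[OF _ Times_ordLeq_omega1])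
      (use \<B>(2) ordIso_imp_ordLeq in auto)
  then have small: "|c ` ?I| \<le>o omega1"
    by (rule image_ordLeq_omega1)
  have base: "\<exists>C\<in>c ` ?I. x \<in> C \<and> C \<subseteq> U" if "openin X U" "x \<in> U" for U x
  proof -
    obtain B where B: "B \<in> \<B>" "x \<in> B" "B \<subseteq> U"
      using base_of_refine[OF \<B>(1) \<open>openin X U\<close> \<open>x \<in> U\<close>] by blast
    then have "openin X B"
      using \<B>(1) unfolding base_of_def by blast
    then obtain C where C: "clopenin X C" "x \<in> C" "C \<subseteq> B"
      using regular_P_space_clopen_neighbourhood[OF reg P] B(2) by metis
    then obtain A where A: "A \<in> \<B>" "x \<in> A" "A \<subseteq> C"
      using base_of_refine[OF \<B>(1)] by metis
    have "(A, B) \<in> ?I"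
      using A B C by auto
    moreover have "x \<in> c (A, B) \<and> c (A, B) \<subseteq> U"
      using c[OF \<open>(A, B) \<in> ?I\<close>] A B by auto
    ultimately show ?thesis
      by (intro bexI[of _ "c (A, B)"] imageI)
  qed
  have clo: "clopenin X C" if C: "C \<in> c ` ?I" for C
  proof -
    obtain AB where "C = c AB" "AB \<in> ?I"
      using C by (rule imageE)
    then show ?thesis
      using c[of AB] by (simp add: case_prod_beta)
  qed
  have "base_of X (c ` ?I)"
    unfolding base_of_def
  proof (intro conjI ballI allI impI)
    show "openin X C" if "C \<in> c ` ?I" for C
      using clo[OF that] ..
    show "\<exists>V\<in>c ` ?I. x \<in> V \<and> V \<subseteq> U" if "openin X U \<and> x \<in> U" for U x
      using that by (intro base) auto
  qed
  then show thesis
    by (rule that[OF _ small clo])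
qed

section \<open>Traces of a family of sets\<close>

text \<open>
  A trace is a point of the closure of \<open>U\<close> in the Cantor cube over \<open>\<B>\<close>, written as the set of
  coordinates with value \<open>True\<close>. Traces correspond to the ultrafilters of the algebra of subsets of \<open>U\<close>
  generated by \<open>\<B>\<close>. Working with sets in place of functions keeps the inductive part of the
  proof free of topologies on auxiliary types.
\<close>

definition traces :: "'a set \<Rightarrow> 'a set set \<Rightarrow> 'a set set set"
  where "traces U \<B> =
    {t. t \<subseteq> \<B> \<and> (\<forall>F. finite F \<and> F \<subseteq> \<B> \<longrightarrow> (\<exists>x\<in>U. \<forall>B\<in>F. B \<in> t \<longleftrightarrow> x \<in> B))}"

text \<open>
  This is scatteredness of \<open>T\<close> as a subspace of the power set with the topology of
  pointwise convergence, in which agreement on a finite set is a basic neighbourhood.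
\<close>

definition scattered_sets :: "'b set set \<Rightarrow> bool"
  where "scattered_sets T \<longleftrightarrow>
    (\<forall>S. S \<subseteq> T \<and> S \<noteq> {} \<longrightarrow> (\<exists>t\<in>S. \<exists>F. finite F \<and> (\<forall>s\<in>S. s \<inter> F = t \<inter> F \<longrightarrow> s = t)))"

lemma scattered_setsE:
  assumes "scattered_sets T" "S \<subseteq> T" "S \<noteq> {}"
  obtains t F where "t \<in> S" "finite F" "\<And>s. s \<in> S \<Longrightarrow> s \<inter> F = t \<inter> F \<Longrightarrow> s = t"
  using assms unfolding scattered_sets_def by meson

lemma traces_subset: "t \<in> traces U \<B> \<Longrightarrow> t \<subseteq> \<B>"
  by (simp add: traces_def)

lemma tracesE:
  assumes "t \<in> traces U \<B>" "finite F" "F \<subseteq> \<B>"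
  obtains x where "x \<in> U" "\<And>B. B \<in> F \<Longrightarrow> B \<in> t \<longleftrightarrow> x \<in> B"
proof -
  have "\<exists>x\<in>U. \<forall>B\<in>F. B \<in> t \<longleftrightarrow> x \<in> B"
    using assms by (simp add: traces_def)
  then show thesis
    using that by blast
qed

lemma traces_mono_mem:
  assumes t: "t \<in> traces U \<B>" and "A \<in> t" "B \<in> \<B>" "A \<subseteq> B"
  shows "B \<in> t"
proof -
  have F: "finite {A, B}" "{A, B} \<subseteq> \<B>"
    using traces_subset[OF t] assms by auto
  obtain x where x: "\<And>C. C \<in> {A, B} \<Longrightarrow> C \<in> t \<longleftrightarrow> x \<in> C"
    by (rule tracesE[OF t F]) (rule that)
  show ?thesis
    using x[of A] x[of B] assms by auto
qed

lemma traces_disjoint_mem: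
  assumes t: "t \<in> traces U \<B>" and "A \<in> t" "B \<in> \<B>" "A \<inter> B = {}"
  shows "B \<notin> t"
proof -
  have F: "finite {A, B}" "{A, B} \<subseteq> \<B>"
    using traces_subset[OF t] assms by auto
  obtain x where x: "\<And>C. C \<in> {A, B} \<Longrightarrow> C \<in> t \<longleftrightarrow> x \<in> C"
    by (rule tracesE[OF t F]) (rule that)
  show ?thesis
    using x[of A] x[of B] assms by auto
qed

text \<open>
  Scatteredness pulls back along continuous injections; the last hypothesis expresses
  continuity.
\<close>

lemma scattered_sets_inj_preimage:
  assumes T: "scattered_sets T" and \<phi>: "\<phi> ` T' \<subseteq> T" "inj_on \<phi> T'"
    and cont: "\<And>F. finite F \<Longrightarrow>
      \<exists>F'. finite F' \<and> (\<forall>s\<in>T'. \<forall>t\<in>T'. s \<inter> F' = t \<inter> F' \<longrightarrow> \<phi> s \<inter> F = \<phi> t \<inter> F)"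
  shows "scattered_sets T'"
  unfolding scattered_sets_def
proof (intro allI impI)
  fix S assume S: "S \<subseteq> T' \<and> S \<noteq> {}"
  then have S': "\<phi> ` S \<subseteq> T" "\<phi> ` S \<noteq> {}"
    using \<phi>(1) by auto
  obtain t F where t: "t \<in> \<phi> ` S" and "finite F"
    and iso: "\<And>s. s \<in> \<phi> ` S \<Longrightarrow> s \<inter> F = t \<inter> F \<Longrightarrow> s = t"
    by (rule scattered_setsE[OF T S']) (rule that; assumption)
  obtain t' where t': "t' \<in> S" "t = \<phi> t'"
    using t by blast
  obtain F' where F': "finite F'"
    "\<forall>s\<in>T'. \<forall>t\<in>T'. s \<inter> F' = t \<inter> F' \<longrightarrow> \<phi> s \<inter> F = \<phi> t \<inter> F"
    using cont[OF \<open>finite F\<close>] by blast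
  have "s = t'" if "s \<in> S" "s \<inter> F' = t' \<inter> F'" for s
  proof -
    have "\<phi> s \<inter> F = t \<inter> F"
      using F'(2) that S t' by blast
    then have "\<phi> s = \<phi> t'"
      using iso that(1) t'(2) by blast
    then show ?thesis
      using \<phi>(2) S that(1) t'(1) by (meson inj_onD subsetD)
  qed
  then show "\<exists>t\<in>S. \<exists>F. finite F \<and> (\<forall>s\<in>S. s \<inter> F = t \<inter> F \<longrightarrow> s = t)"
    using t'(1) F'(1) by blast
qed

text \<open>
  The basic open sets are indexed by pairs of finite subsets of \<open>A\<close>, so those of cardinality at
  most \<open>omega1\<close> have a union of cardinality at most \<open>omega1\<close>. A point isolated in the complement
  of that union would have a basic neighbourhood with only one more point, which is again of
  cardinality at most \<open>omega1\<close>; so the complement is empty.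
\<close>

lemma card_scattered_sets:
  assumes T: "scattered_sets T" and sub: "\<And>t. t \<in> T \<Longrightarrow> t \<subseteq> A" and A: "|A| \<le>o omega1"
  shows "|T| \<le>o omega1"
proof -
  define cell where "cell = (\<lambda>(F, P). {t \<in> T. t \<inter> F = P})"
  define I where "I = {c \<in> Fpow A \<times> Fpow A. |cell c| \<le>o omega1}"
  have "|I| \<le>o omega1"
    unfolding I_def
    by (rule subset_ordLeq_omega1[OF _ Times_ordLeq_omega1]) (use Fpow_ordLeq_omega1[OF A] in auto)
  then have small: "|\<Union>c\<in>I. cell c| \<le>o omega1"
    by (rule UNION_ordLeq_omega1) (simp add: I_def)
  have "T - (\<Union>c\<in>I. cell c) = {}"
  proof (rule ccontr)
    assume ne: "T - (\<Union>c\<in>I. cell c) \<noteq> {}"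
    obtain t F where t: "t \<in> T - (\<Union>c\<in>I. cell c)" and F: "finite F"
      and iso: "\<And>s. s \<in> T - (\<Union>c\<in>I. cell c) \<Longrightarrow> s \<inter> F = t \<inter> F \<Longrightarrow> s = t"
      by (rule scattered_setsE[OF T Diff_subset ne]) (rule that; assumption)
    define c where "c = (F \<inter> A, t \<inter> F)"
    have cell: "cell c = {s \<in> T. s \<inter> F = t \<inter> F}"
      using sub by (fastforce simp: c_def cell_def)
    have "cell c \<subseteq> insert t (\<Union>c\<in>I. cell c)"
    proof
      fix s assume s: "s \<in> cell c"
      show "s \<in> insert t (\<Union>c\<in>I. cell c)"
      proof (cases "s \<in> (\<Union>c\<in>I. cell c)")
        case False
        then have "s = t"
          by (intro iso) (use s cell in auto)
        then show ?thesis
          by simp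
      qed simp
    qed
    moreover have "|insert t (\<Union>c\<in>I. cell c)| \<le>o omega1"
      using Un_ordLeq_omega1[OF countable_imp_ordLeq_omega1[of "{t}"] small] by simp
    ultimately have "|cell c| \<le>o omega1"
      by (rule subset_ordLeq_omega1)
    moreover have "c \<in> Fpow A \<times> Fpow A"
      using F t sub by (auto simp: c_def Fpow_def)
    ultimately have "c \<in> I"
      by (simp add: I_def)
    moreover have "t \<in> cell c"
      using t by (simp add: cell)
    ultimately show False
      using t by blast
  qed
  then show ?thesis
    using small subset_ordLeq_omega1[of T] by blast
qed


section \<open>Scattered subbases\<close>

text \<open>
  The third clause says that the sets in \<open>\<B>\<close> and their complements form a subbase of the
  topology of \<open>U\<close>.
\<close>

definition scattered_subbase :: "'a topology \<Rightarrow> 'a set \<Rightarrow> 'a set set \<Rightarrow> bool"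
  where "scattered_subbase X U \<B> \<longleftrightarrow>
    |\<B>| \<le>o omega1 \<and>
    (\<forall>B\<in>\<B>. clopenin X B \<and> B \<subseteq> U) \<and>
    (\<forall>x\<in>U. \<forall>W. openin X W \<and> x \<in> W \<longrightarrow>
      (\<exists>F. finite F \<and> F \<subseteq> \<B> \<and> (\<forall>y\<in>U. (\<forall>B\<in>F. y \<in> B \<longleftrightarrow> x \<in> B) \<longrightarrow> y \<in> W))) \<and>
    scattered_sets (traces U \<B>)"

definition tame :: "'a topology \<Rightarrow> 'a set \<Rightarrow> bool"
  where "tame X U \<longleftrightarrow> clopenin X U \<and> (\<exists>\<B>. scattered_subbase X U \<B>)"

lemma scattered_subbaseI:
  assumes "|\<B>| \<le>o omega1" and "\<And>B. B \<in> \<B> \<Longrightarrow> clopenin X B \<and> B \<subseteq> U"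
    and "\<And>x W. x \<in> U \<Longrightarrow> openin X W \<Longrightarrow> x \<in> W \<Longrightarrow>
      \<exists>F. finite F \<and> F \<subseteq> \<B> \<and> (\<forall>y\<in>U. (\<forall>B\<in>F. y \<in> B \<longleftrightarrow> x \<in> B) \<longrightarrow> y \<in> W)"
    and "scattered_sets (traces U \<B>)"
  shows "scattered_subbase X U \<B>"
  using assms by (simp add: scattered_subbase_def)

lemma scattered_subbase_card: "scattered_subbase X U \<B> \<Longrightarrow> |\<B>| \<le>o omega1"
  by (simp add: scattered_subbase_def)

lemma scattered_subbase_clopenin: "scattered_subbase X U \<B> \<Longrightarrow> B \<in> \<B> \<Longrightarrow> clopenin X B"
  by (simp add: scattered_subbase_def)

lemma scattered_subbase_subset: "scattered_subbase X U \<B> \<Longrightarrow> B \<in> \<B> \<Longrightarrow> B \<subseteq> U"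
  by (simp add: scattered_subbase_def)

lemma scattered_subbase_traces: "scattered_subbase X U \<B> \<Longrightarrow> scattered_sets (traces U \<B>)"
  by (simp add: scattered_subbase_def)

lemma scattered_subbase_separates:
  assumes "scattered_subbase X U \<B>" "openin X W" "x \<in> W" "x \<in> U"
  shows "\<exists>F. finite F \<and> F \<subseteq> \<B> \<and> (\<forall>y\<in>U. (\<forall>B\<in>F. y \<in> B \<longleftrightarrow> x \<in> B) \<longrightarrow> y \<in> W)"
  using assms by (simp add: scattered_subbase_def)

text \<open>
  Intersecting the family with \<open>D\<close> works: the closure of \<open>D\<close> embeds into the closure of \<open>U\<close>, by
  sending a trace on \<open>D\<close> to the set of members whose intersection with \<open>D\<close> belongs to it.
\<close>

lemma tame_clopen_subset:
  assumes U: "tame X U" and D: "clopenin X D" "D \<subseteq> U"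
  shows "tame X D"
proof -
  obtain \<B> where \<B>: "scattered_subbase X U \<B>"
    using U unfolding tame_def by blast
  define \<D> where "\<D> = (\<lambda>B. B \<inter> D) ` \<B>"
  have card: "|\<D>| \<le>o omega1"
    unfolding \<D>_def by (rule image_ordLeq_omega1[OF scattered_subbase_card[OF \<B>]])
  have clo: "clopenin X B \<and> B \<subseteq> D" if "B \<in> \<D>" for B
    using that scattered_subbase_clopenin[OF \<B>] D(1) by (auto simp: \<D>_def)
  have sep: "\<exists>F. finite F \<and> F \<subseteq> \<D> \<and> (\<forall>y\<in>D. (\<forall>B\<in>F. y \<in> B \<longleftrightarrow> x \<in> B) \<longrightarrow> y \<in> W)"
    if x: "x \<in> D" "openin X W" "x \<in> W" for x W
  proof -
    obtain F where F: "finite F" "F \<subseteq> \<B>"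
      "\<forall>y\<in>U. (\<forall>B\<in>F. y \<in> B \<longleftrightarrow> x \<in> B) \<longrightarrow> y \<in> W"
      using scattered_subbase_separates[OF \<B> x(2,3) subsetD[OF D(2) x(1)]] by blast
    have "y \<in> W" if y: "y \<in> D" "\<forall>B\<in>(\<lambda>B. B \<inter> D) ` F. y \<in> B \<longleftrightarrow> x \<in> B" for y
      by (rule F(3)[rule_format]) (use y x(1) D(2) in auto)
    then show ?thesis
      using F(1,2) by (intro exI[of _ "(\<lambda>B. B \<inter> D) ` F"]) (auto simp: \<D>_def)
  qed
  define \<phi> where "\<phi> = (\<lambda>t. {B \<in> \<B>. B \<inter> D \<in> t})"
  have "\<phi> t \<in> traces U \<B>" if t: "t \<in> traces D \<D>" for t
    unfolding traces_def
  proof (intro CollectI conjI allI impI)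
    show "\<phi> t \<subseteq> \<B>"
      by (auto simp: \<phi>_def)
    fix F assume F: "finite F \<and> F \<subseteq> \<B>"
    obtain x where x: "x \<in> D" "\<And>B. B \<in> (\<lambda>B. B \<inter> D) ` F \<Longrightarrow> B \<in> t \<longleftrightarrow> x \<in> B"
      by (rule tracesE[OF t, of "(\<lambda>B. B \<inter> D) ` F"]) (use F in \<open>auto simp: \<D>_def\<close>)
    have "\<forall>B\<in>F. B \<in> \<phi> t \<longleftrightarrow> x \<in> B"
      using x F by (auto simp: \<phi>_def)
    then show "\<exists>x\<in>U. \<forall>B\<in>F. B \<in> \<phi> t \<longleftrightarrow> x \<in> B"
      using x(1) D(2) by blast
  qed
  then have \<phi>_traces: "\<phi> ` traces D \<D> \<subseteq> traces U \<B>"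
    by blast
  have \<phi>_inj: "inj_on \<phi> (traces D \<D>)"
  proof (rule inj_on_inverseI)
    fix t assume t: "t \<in> traces D \<D>"
    show "(\<lambda>B. B \<inter> D) ` \<phi> t = t"
      using traces_subset[OF t] by (auto simp: \<phi>_def \<D>_def)
  qed
  have \<phi>_agree: "\<phi> s \<inter> F = \<phi> t \<inter> F"
    if "s \<inter> (\<lambda>B. B \<inter> D) ` F = t \<inter> (\<lambda>B. B \<inter> D) ` F" for s t F
  proof -
    have "B \<inter> D \<in> s \<longleftrightarrow> B \<inter> D \<in> t" if "B \<in> F" for B
      using \<open>s \<inter> _ = _\<close> that by blast
    then show ?thesis
      by (auto simp: \<phi>_def)
  qed
  have scat: "scattered_sets (traces D \<D>)"
  proof (rule scattered_sets_inj_preimage[OF scattered_subbase_traces[OF \<B>] \<phi>_traces \<phi>_inj])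
    show "\<exists>F'. finite F' \<and>
        (\<forall>s\<in>traces D \<D>. \<forall>t\<in>traces D \<D>. s \<inter> F' = t \<inter> F' \<longrightarrow> \<phi> s \<inter> F = \<phi> t \<inter> F)"
      if "finite F" for F
      by (rule exI[of _ "(\<lambda>B. B \<inter> D) ` F"]) (intro conjI ballI impI finite_imageI that \<phi>_agree)
  qed
  have "scattered_subbase X D \<D>"
    by (rule scattered_subbaseI) (fact card clo sep scat)+
  then show ?thesis
    using D(1) unfolding tame_def by blast
qed

text \<open>
  The order is a well-order of \<open>A\<close> of least possible type: its proper initial segments have
  smaller cardinality than \<open>A\<close>, hence are countable.
\<close>

lemma omega1_enumeration:
  assumes A: "|A| \<le>o omega1"
  obtains lt where "\<And>a. \<not> lt a a" "\<And>a b c. lt a b \<Longrightarrow> lt b c \<Longrightarrow> lt a c"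
    "\<And>a b. a \<in> A \<Longrightarrow> b \<in> A \<Longrightarrow> a \<noteq> b \<Longrightarrow> lt a b \<or> lt b a"
    "\<And>S. S \<subseteq> A \<Longrightarrow> S \<noteq> {} \<Longrightarrow> \<exists>a\<in>S. \<forall>b\<in>S. b \<noteq> a \<longrightarrow> lt a b"
    "\<And>a. a \<in> A \<Longrightarrow> countable {b \<in> A. lt b a}"
proof -
  define r where "r = |A|"
  define lt where "lt = (\<lambda>a b. (a, b) \<in> r \<and> a \<noteq> b)"
  have r: "Card_order r" "Field r = A"
    unfolding r_def by (rule card_of_Card_order, rule Field_card_of)
  have wo: "Well_order r"
    unfolding r_def by (rule card_of_Well_order)
  then have lin: "trans r" "antisym r" "total_on A r" "wf (r - Id)"
    by (auto simp: r(2) well_order_on_def linear_order_on_def partial_order_on_def preorder_on_def)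
  show thesis
  proof (rule that[of lt])
    show "lt a c" if "lt a b" "lt b c" for a b c
      using that lin(1,2) unfolding lt_def by (meson antisymD transD)
    show tot: "lt a b \<or> lt b a" if "a \<in> A" "b \<in> A" "a \<noteq> b" for a b
      using that lin(3) unfolding lt_def total_on_def by blast
    show "\<exists>a\<in>S. \<forall>b\<in>S. b \<noteq> a \<longrightarrow> lt a b" if S: "S \<subseteq> A" "S \<noteq> {}" for S
    proof -
      obtain a where "a \<in> S" and a: "\<And>b. (b, a) \<in> r - Id \<Longrightarrow> b \<notin> S"
        using wfE_min'[OF lin(4) S(2)] by blast
      have "lt a b" if "b \<in> S" "b \<noteq> a" for b
        using tot[of a b] a[of b] that S(1) \<open>a \<in> S\<close> by (auto simp: lt_def)
      then show ?thesis
        using \<open>a \<in> S\<close> by blast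
    qed
    show "countable {b \<in> A. lt b a}" if "a \<in> A" for a
    proof -
      have "|underS r a| <o r"
        using card_of_underS[OF r(1)] that r(2) by blast
      then have "|underS r a| <o omega1"
        using A ordLess_ordLeq_trans unfolding r_def by blast
      moreover have "{b \<in> A. lt b a} \<subseteq> underS r a"
        by (auto simp: lt_def underS_def)
      ultimately show ?thesis
        using countable_iff_ordLess_omega1 countable_subset by blast
    qed
  qed (auto simp: lt_def)
qed

text \<open>
  The hypothesis on the points of \<open>U\<close> outside \<open>\<Union>\<W>\<close> is what the initial unions need in order to
  generate the topology there. It holds vacuously when \<open>\<W>\<close> covers \<open>U\<close>, and it holds when \<open>\<W>\<close>
  consists of the complements of a neighbourhood base of a single omitted point.
\<close>

lemma tame_glue:
  assumes P: "P_space X" and U: "clopenin X U"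
    and W: "|\<W>| \<le>o omega1" "\<And>G. G \<in> \<W> \<Longrightarrow> tame X G" "\<And>G. G \<in> \<W> \<Longrightarrow> G \<subseteq> U"
    and rest: "\<And>x N. x \<in> U - \<Union>\<W> \<Longrightarrow> openin X N \<Longrightarrow> x \<in> N \<Longrightarrow> \<exists>G\<in>\<W>. U - G \<subseteq> N"
  shows "tame X U"
proof -
  obtain lt where lt: "\<And>G. \<not> lt G G" "\<And>G H K. lt G H \<Longrightarrow> lt H K \<Longrightarrow> lt G K"
    "\<And>G H. G \<in> \<W> \<Longrightarrow> H \<in> \<W> \<Longrightarrow> G \<noteq> H \<Longrightarrow> lt G H \<or> lt H G"
    and least: "\<And>S. S \<subseteq> \<W> \<Longrightarrow> S \<noteq> {} \<Longrightarrow> \<exists>G\<in>S. \<forall>H\<in>S. H \<noteq> G \<longrightarrow> lt G H"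
    and cnt: "\<And>G. G \<in> \<W> \<Longrightarrow> countable {H \<in> \<W>. lt H G}"
    by (rule omega1_enumeration[OF W(1)]) (rule that; assumption)
  define L where "L = (\<lambda>G. \<Union>{H \<in> \<W>. lt H G})"
  define J where "J = (\<lambda>G. L G \<union> G)"
  define D where "D = (\<lambda>G. G - L G)"
  have cloW: "clopenin X G" if "G \<in> \<W>" for G
    using W(2) that unfolding tame_def by blast
  have cloL: "clopenin X (L G)" if "G \<in> \<W>" for G
    unfolding L_def
    by (rule P_space_clopenin_countable_Union[OF P cnt[OF that]]) (use cloW in blast)
  have cloJ: "clopenin X (J G)" and cloD: "clopenin X (D G)" if "G \<in> \<W>" for G
    using cloL[OF that] cloW[OF that] unfolding J_def D_def by auto
  have LU: "L G \<subseteq> U" for G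
    using W(3) unfolding L_def by blast
  have JU: "J G \<subseteq> U" and DU: "D G \<subseteq> U" if "G \<in> \<W>" for G
    using W(3)[OF that] LU[of G] unfolding J_def D_def by blast+
  have J_lt: "J G \<subseteq> L H" if "lt G H" "G \<in> \<W>" for G H
    using that lt(2) unfolding J_def L_def by blast
  have J_mono: "J G \<subseteq> J H" if "lt G H" "G \<in> \<W>" for G H
    using J_lt[OF that] unfolding J_def by blast
  have DJ_disj: "D H \<inter> J G = {}" if "lt G H" "G \<in> \<W>" for G H
    using J_lt[OF that] unfolding D_def by blast
  have DJ_sub: "D H \<subseteq> J G" if "G = H \<or> lt H G" "H \<in> \<W>" for G H
    using that unfolding D_def J_def L_def by blast
  have D_disj: "D G \<inter> D H = {}" if "G \<in> \<W>" "H \<in> \<W>" "G \<noteq> H" for G H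
    using lt(3)[OF that] DJ_disj[of G H] DJ_disj[of H G] DJ_sub[of G G] DJ_sub[of H H] that
    by blast
  have D_cover: "\<exists>H\<in>\<W>. x \<in> D H" if x: "x \<in> \<Union>\<W>" for x
  proof -
    obtain H where H: "H \<in> \<W>" "x \<in> H" "\<And>G. G \<in> \<W> \<Longrightarrow> x \<in> G \<Longrightarrow> G \<noteq> H \<Longrightarrow> lt H G"
      using least[of "{G \<in> \<W>. x \<in> G}"] x by blast
    then have "x \<notin> L H"
      using lt(1,2) unfolding L_def by blast
    then show ?thesis
      using H unfolding D_def by blast
  qed
  have "\<forall>G\<in>\<W>. \<exists>E. scattered_subbase X (D G) E"
  proof
    fix G assume G: "G \<in> \<W>"
    have "tame X (D G)"
      by (rule tame_clopen_subset[OF W(2)[OF G] cloD[OF G]]) (simp add: D_def)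
    then show "\<exists>E. scattered_subbase X (D G) E"
      unfolding tame_def by blast
  qed
  then obtain E where E: "\<And>G. G \<in> \<W> \<Longrightarrow> scattered_subbase X (D G) (E G)"
    by metis
  define \<B> where "\<B> = D ` \<W> \<union> J ` \<W> \<union> (\<Union>G\<in>\<W>. E G)"
  have B_in: "D G \<in> \<B>" "J G \<in> \<B>" "E G \<subseteq> \<B>" if "G \<in> \<W>" for G
    using that unfolding \<B>_def by blast+
  have card: "|\<B>| \<le>o omega1"
    unfolding \<B>_def
    by (intro Un_ordLeq_omega1 image_ordLeq_omega1 UNION_ordLeq_omega1 W(1)
        scattered_subbase_card[OF E])
  have E_sub: "B \<subseteq> D G" if "B \<in> E G" "G \<in> \<W>" for B G
    using scattered_subbase_subset[OF E] that by blast
  have clo: "clopenin X B \<and> B \<subseteq> U" if B: "B \<in> \<B>" for B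
  proof -
    consider G where "G \<in> \<W>" "B = D G" | G where "G \<in> \<W>" "B = J G" | G where "G \<in> \<W>" "B \<in> E G"
      using B unfolding \<B>_def by blast
    then show ?thesis
    proof cases
      case 3
      then show ?thesis
        using scattered_subbase_clopenin[OF E] E_sub DU by blast
    qed (use cloD DU cloJ JU in auto)
  qed
  have sep: "\<exists>F. finite F \<and> F \<subseteq> \<B> \<and> (\<forall>y\<in>U. (\<forall>B\<in>F. y \<in> B \<longleftrightarrow> x \<in> B) \<longrightarrow> y \<in> N)"
    if x: "x \<in> U" "openin X N" "x \<in> N" for x N
  proof (cases "x \<in> \<Union>\<W>")
    case True
    then obtain G where G: "G \<in> \<W>" "x \<in> D G"
      using D_cover by blast
    obtain F where F: "finite F" "F \<subseteq> E G"
      "\<forall>y\<in>D G. (\<forall>B\<in>F. y \<in> B \<longleftrightarrow> x \<in> B) \<longrightarrow> y \<in> N"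
      using scattered_subbase_separates[OF E[OF G(1)] x(2,3) G(2)] by blast
    show ?thesis
      by (rule exI[of _ "insert (D G) F"]) (use F G B_in[OF G(1)] in auto)
  next
    case False
    then obtain G where G: "G \<in> \<W>" "U - G \<subseteq> N"
      using rest x by blast
    have "x \<notin> J G"
      using False G(1) unfolding J_def L_def by blast
    moreover have "U - J G \<subseteq> N"
      using G(2) unfolding J_def by blast
    ultimately show ?thesis
      by (intro exI[of _ "{J G}"]) (use B_in[OF G(1)] in auto)
  qed
  \<comment> \<open>No member of \<open>\<B>\<close> outside \<open>E G\<close> splits the piece \<open>D G\<close>, so a trace that contains \<open>D G\<close> is
    determined by its restriction to \<open>E G\<close>.\<close>
  have tri: "B \<inter> D G = {} \<or> D G \<subseteq> B \<or> B \<in> E G" if B: "B \<in> \<B>" and G: "G \<in> \<W>" for B G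
  proof -
    consider H where "H \<in> \<W>" "B = D H" | H where "H \<in> \<W>" "B = J H" | H where "H \<in> \<W>" "B \<in> E H"
      using B unfolding \<B>_def by blast
    then show ?thesis
    proof cases
      case 1
      then show ?thesis
        using D_disj G by blast
    next
      case 2
      then show ?thesis
        using DJ_disj[of H G] DJ_sub[of H G] lt(3)[of G H] G by blast
    next
      case 3
      then show ?thesis
        using D_disj[of H G] E_sub[of B H] G by blast
    qed
  qed
  have scat_D: "scattered_sets {t \<in> traces U \<B>. D G \<in> t}" (is "scattered_sets ?T")
    if G: "G \<in> \<W>" for G
  proof (rule scattered_sets_inj_preimage[OF scattered_subbase_traces[OF E[OF G]], of "\<lambda>t. t \<inter> E G"])
    show "(\<lambda>t. t \<inter> E G) ` ?T \<subseteq> traces (D G) (E G)"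
    proof (rule image_subsetI)
      fix t assume t: "t \<in> ?T"
      show "t \<inter> E G \<in> traces (D G) (E G)"
        unfolding traces_def
      proof (intro CollectI conjI allI impI)
        fix F assume F: "finite F \<and> F \<subseteq> E G"
        obtain x where x: "\<And>B. B \<in> insert (D G) F \<Longrightarrow> B \<in> t \<longleftrightarrow> x \<in> B"
          by (rule tracesE[of t U \<B> "insert (D G) F"])
            (use t F B_in[OF G] that in \<open>blast+\<close>)
        have "\<forall>B\<in>F. B \<in> t \<inter> E G \<longleftrightarrow> x \<in> B"
          using x F by blast
        moreover have "x \<in> D G"
          using x[of "D G"] t by blast
        ultimately show "\<exists>x\<in>D G. \<forall>B\<in>F. B \<in> t \<inter> E G \<longleftrightarrow> x \<in> B"
          by blast
      qed blast
    qed
    have sub: "s \<subseteq> t" if s: "s \<in> ?T" and t: "t \<in> ?T" and eq: "s \<inter> E G = t \<inter> E G" for s t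
    proof
      fix B assume B: "B \<in> s"
      then have "B \<in> \<B>"
        using traces_subset s by blast
      then consider "B \<inter> D G = {}" | "D G \<subseteq> B" | "B \<in> E G"
        using tri G by blast
      then show "B \<in> t"
      proof cases
        case 1
        then show ?thesis
          using traces_disjoint_mem[of s U \<B> "D G" B] s B \<open>B \<in> \<B>\<close> by blast
      next
        case 2
        then show ?thesis
          using traces_mono_mem[of t U \<B> "D G" B] t \<open>B \<in> \<B>\<close> by blast
      next
        case 3
        then show ?thesis
          using B eq by blast
      qed
    qed
    show "inj_on (\<lambda>t. t \<inter> E G) ?T"
      by (intro inj_onI subset_antisym; rule sub) (simp_all only:)
    show "\<exists>F'. finite F' \<and> (\<forall>s\<in>?T. \<forall>t\<in>?T. s \<inter> F' = t \<inter> F' \<longrightarrow> s \<inter> E G \<inter> F = t \<inter> E G \<inter> F)"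
      if "finite F" for F
      by (rule exI[of _ F]) (use that in blast)
  qed
  have scat: "scattered_sets (traces U \<B>)"
    unfolding scattered_sets_def
  proof (intro allI impI)
    fix S assume S: "S \<subseteq> traces U \<B> \<and> S \<noteq> {}"
    show "\<exists>t\<in>S. \<exists>F. finite F \<and> (\<forall>s\<in>S. s \<inter> F = t \<inter> F \<longrightarrow> s = t)"
    proof (cases "\<exists>t\<in>S. \<exists>G\<in>\<W>. D G \<in> t")
      case True
      then obtain t0 G where G: "G \<in> \<W>" and t0: "t0 \<in> S" "D G \<in> t0"
        by blast
      have S_G: "{t \<in> S. D G \<in> t} \<subseteq> {t \<in> traces U \<B>. D G \<in> t}" "{t \<in> S. D G \<in> t} \<noteq> {}"
        using S t0 by auto
      obtain t F where t: "t \<in> {t \<in> S. D G \<in> t}" and "finite F"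
        and iso: "\<And>s. s \<in> {t \<in> S. D G \<in> t} \<Longrightarrow> s \<inter> F = t \<inter> F \<Longrightarrow> s = t"
        by (rule scattered_setsE[OF scat_D[OF G] S_G]) (rule that; assumption)
      have "s = t" if s: "s \<in> S" "s \<inter> insert (D G) F = t \<inter> insert (D G) F" for s
        by (rule iso) (use s t in blast)+
      then show ?thesis
        using t \<open>finite F\<close> by (intro bexI[of _ t] exI[of _ "insert (D G) F"]) auto
    next
      case False
      \<comment> \<open>The members of \<open>E G\<close> are subsets of \<open>D G\<close>, so a trace without pieces has none of them.\<close>
      have only_J: "\<exists>G\<in>\<W>. B = J G" if B: "B \<in> t" and t: "t \<in> S" for B t
      proof (rule ccontr)
        assume contra: "\<not> (\<exists>G\<in>\<W>. B = J G)"
        have tr: "t \<in> traces U \<B>"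
          using t S by blast
        have "B \<in> \<B>"
          using traces_subset[OF tr] B by blast
        then obtain G where G: "G \<in> \<W>" "B \<subseteq> D G"
          using contra E_sub unfolding \<B>_def by blast
        then have "D G \<in> t"
          using traces_mono_mem[OF tr B] B_in by blast
        then show False
          using False G(1) t by blast
      qed
      show ?thesis
      proof (cases "\<exists>t\<in>S. \<exists>G\<in>\<W>. J G \<in> t")
        case True
        then obtain G where G: "G \<in> \<W>" "\<exists>t\<in>S. J G \<in> t"
          and G_least: "\<And>H. H \<in> \<W> \<Longrightarrow> \<exists>t\<in>S. J H \<in> t \<Longrightarrow> H \<noteq> G \<Longrightarrow> lt G H"
          using least[of "{G \<in> \<W>. \<exists>t\<in>S. J G \<in> t}"] by blast
        \<comment> \<open>The earliest \<open>G\<close> with \<open>J G\<close> in some trace of \<open>S\<close> determines every trace containing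
          \<open>J G\<close>: traces are closed upwards, and nothing earlier occurs.\<close>
        have J_iff: "{B. B \<in> s} = {J H | H. H \<in> \<W> \<and> (H = G \<or> lt G H)}"
          if s: "s \<in> S" "J G \<in> s" for s
        proof (intro set_eqI iffI)
          fix B assume "B \<in> {B. B \<in> s}"
          then obtain H where H: "H \<in> \<W>" "B = J H" "J H \<in> s"
            using only_J s(1) by blast
          then show "B \<in> {J H | H. H \<in> \<W> \<and> (H = G \<or> lt G H)}"
            using G_least s(1) by blast
        next
          fix B assume "B \<in> {J H | H. H \<in> \<W> \<and> (H = G \<or> lt G H)}"
          then obtain H where H: "H \<in> \<W>" "H = G \<or> lt G H" "B = J H"
            by blast
          then have "J G \<subseteq> J H"
            using J_mono G(1) by blast
          then show "B \<in> {B. B \<in> s}"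
            using traces_mono_mem[of s U \<B> "J G" "J H"] s S H B_in(2)[OF H(1)] by blast
        qed
        obtain t where t: "t \<in> S" "J G \<in> t"
          using G(2) by blast
        have "s = t" if "s \<in> S" "s \<inter> {J G} = t \<inter> {J G}" for s
        proof -
          have "J G \<in> s"
            using that(2) t(2) by blast
          then show ?thesis
            using J_iff[OF that(1)] J_iff[OF t] by simp
        qed
        then show ?thesis
          using t(1) by (intro bexI[of _ t] exI[of _ "{J G}"]) auto
      next
        case False
        have "s = {}" if s: "s \<in> S" for s
        proof (rule equals0I)
          fix B assume "B \<in> s"
          then show False
            using only_J[of B s] False s by blast
        qed
        then show ?thesis
          using S by (metis ex_in_conv finite.emptyI)
      qed
    qed
  qed
  have "scattered_subbase X U \<B>"
    by (rule scattered_subbaseI) (fact card clo sep scat)+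
  then show ?thesis
    using U unfolding tame_def by blast
qed

text \<open>
  A base of cardinality at most \<open>omega1\<close> turns an arbitrary tame cover into one that can be
  glued: tameness passes to clopen subsets, so the tame members of the base already cover \<open>U\<close>.
\<close>

lemma tame_if_locally_tame:
  assumes P: "P_space X" and \<C>: "base_of X \<C>" "|\<C>| \<le>o omega1" "\<forall>C\<in>\<C>. clopenin X C"
    and U: "clopenin X U" and local: "\<And>x. x \<in> U \<Longrightarrow> \<exists>G. tame X G \<and> x \<in> G"
  shows "tame X U"
proof (rule tame_glue[OF P U, of "{C \<in> \<C>. C \<subseteq> U \<and> tame X C}"])
  show "|{C \<in> \<C>. C \<subseteq> U \<and> tame X C}| \<le>o omega1"
    by (rule subset_ordLeq_omega1[OF _ \<C>(2)]) blast
  fix x N assume x: "x \<in> U - \<Union>{C \<in> \<C>. C \<subseteq> U \<and> tame X C}"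
  then obtain G where G: "tame X G" "x \<in> G"
    using local by blast
  then have "openin X (U \<inter> G)" "x \<in> U \<inter> G"
    using U x unfolding tame_def by auto
  then obtain C where C: "C \<in> \<C>" "x \<in> C" "C \<subseteq> U \<inter> G"
    using base_of_refine[OF \<C>(1)] by metis
  then have "tame X C"
    using tame_clopen_subset[OF G(1)] \<C>(3) by blast
  then show "\<exists>G\<in>{C \<in> \<C>. C \<subseteq> U \<and> tame X C}. U - G \<subseteq> N"
    using x C by blast
qed auto

text \<open>
  The complements of the basic neighbourhoods of \<open>p\<close> avoid \<open>p\<close>, hence are tame by the preceding
  lemma, and there are at most \<open>omega1\<close> of them.
\<close>

lemma tame_if_locally_tame_except_point:
  assumes t1: "t1_space X" and P: "P_space X"
    and \<C>: "base_of X \<C>" "|\<C>| \<le>o omega1" "\<forall>C\<in>\<C>. clopenin X C"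
    and U: "clopenin X U" and p: "p \<in> U"
    and local: "\<And>x. x \<in> U - {p} \<Longrightarrow> \<exists>G. tame X G \<and> x \<in> G"
  shows "tame X U"
proof (rule tame_glue[OF P U, of "(\<lambda>C. U - C) ` {C \<in> \<C>. p \<in> C}"])
  show "|(\<lambda>C. U - C) ` {C \<in> \<C>. p \<in> C}| \<le>o omega1"
    by (intro image_ordLeq_omega1 subset_ordLeq_omega1[OF _ \<C>(2)]) blast
  show "tame X G" if "G \<in> (\<lambda>C. U - C) ` {C \<in> \<C>. p \<in> C}" for G
  proof -
    obtain C where C: "C \<in> \<C>" "p \<in> C" "G = U - C"
      using \<open>G \<in> _\<close> by blast
    have "clopenin X G"
      using U \<C>(3) C(1,3) by auto
    then show ?thesis
      by (rule tame_if_locally_tame[OF P \<C>]) (use local C in auto)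
  qed
  fix x N assume x: "x \<in> U - \<Union>((\<lambda>C. U - C) ` {C \<in> \<C>. p \<in> C})"
    and N: "openin X N" "x \<in> N"
  have "x = p"
  proof (rule ccontr)
    assume "x \<noteq> p"
    have "openin X (topspace X - {x})"
      by (rule t1_space_openin_delete_point[OF t1])
    moreover have "p \<in> topspace X - {x}"
      using p U openin_subset \<open>x \<noteq> p\<close> by fastforce
    ultimately obtain C where "C \<in> \<C>" "p \<in> C" "C \<subseteq> topspace X - {x}"
      using base_of_refine[OF \<C>(1)] by metis
    then show False
      using x by blast
  qed
  then obtain C where C: "C \<in> \<C>" "p \<in> C" "C \<subseteq> N"
    using base_of_refine[OF \<C>(1) N] by blast
  show "\<exists>G\<in>(\<lambda>C. U - C) ` {C \<in> \<C>. p \<in> C}. U - G \<subseteq> N"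
    by (rule bexI[of _ "U - C"]) (use C in auto)
qed auto

lemma tame_topspace:
  assumes reg: "regular_space X" and t1: "t1_space X" and scat: "scattered_space X"
    and P: "P_space X" and w: "has_weight X omega1"
  shows "tame X (topspace X)"
proof -
  obtain \<C> where \<C>: "base_of X \<C>" "|\<C>| \<le>o omega1" "\<forall>C\<in>\<C>. clopenin X C"
    using small_clopen_base[OF reg P w] by metis
  define R where "R = topspace X - \<Union>{G. tame X G}"
  have "R = {}"
  proof (rule ccontr)
    assume "R \<noteq> {}"
    \<comment> \<open>A clopen neighbourhood meeting the set \<open>R\<close> of bad points only in \<open>p\<close> is locally tame off \<open>p\<close>.\<close>
    then obtain p where p: "p \<in> R" "openin (subtopology X R) {p}"
      using scat unfolding scattered_space_def R_def by (meson Diff_subset)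
    then obtain N where N: "openin X N" "{p} = N \<inter> R"
      unfolding openin_subtopology by blast
    have "p \<in> N"
      using N(2) by blast
    then obtain U where U: "clopenin X U" "p \<in> U" "U \<subseteq> N"
      using regular_P_space_clopen_neighbourhood[OF reg P N(1)] by metis
    have "tame X U"
    proof (rule tame_if_locally_tame_except_point[OF t1 P \<C> U(1,2)])
      fix x assume x: "x \<in> U - {p}"
      then have "x \<in> topspace X" "x \<notin> R"
        using U N openin_subset by fastforce+
      then show "\<exists>G. tame X G \<and> x \<in> G"
        unfolding R_def by blast
    qed
    then show False
      using U(2) p(1) unfolding R_def by blast
  qed
  then have "\<exists>G. tame X G \<and> x \<in> G" if "x \<in> topspace X" for x
    using that unfolding R_def by blast
  then show ?thesis
    by (intro tame_if_locally_tame[OF P \<C>]) auto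
qed

section \<open>The compactification determined by a scattered subbase\<close>

text \<open>
  The evaluation map is an embedding because \<open>\<B>\<close> consists of clopen sets and generates the
  topology, and the closure of its image is compact as a closed subspace of a Cantor cube. The map
  \<open>\<tau>\<close> identifies that closure with the traces of \<open>\<B>\<close>, which transports scatteredness and the bound
  on the cardinality.
\<close>

lemma scattered_subbase_compactification:
  fixes X :: "'a topology"
  assumes t1: "t1_space X" and \<B>: "scattered_subbase X (topspace X) \<B>"
  shows "\<exists>Y :: ('a set \<Rightarrow> bool) topology.
    compactification_of Y X \<and> scattered_space Y \<and> |topspace Y| \<le>o omega1"
proof -
  define P :: "('a set \<Rightarrow> bool) topology" where "P = product_topology (\<lambda>_. discrete_topology UNIV) \<B>"
  define e where "e = (\<lambda>x. \<lambda>B\<in>\<B>. x \<in> B)"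
  define D where "D = e ` topspace X"
  define K where "K = P closure_of D"
  define Y where "Y = subtopology P K"
  define box where "box = (\<lambda>F f. {g \<in> topspace P. \<forall>B\<in>F. g B = f B})"
  have topP: "topspace P = extensional \<B>"
    by (simp add: P_def PiE_UNIV_domain PiE_def)
  have open_box: "openin P (box F f)" if F: "finite F" "F \<subseteq> \<B>" for F f
  proof -
    have "box F f = PiE \<B> (\<lambda>B. if B \<in> F then {f B} else UNIV)"
      using F(2) by (auto simp: box_def topP PiE_def Pi_def)
    moreover have "openin P \<dots>"
      unfolding P_def openin_PiE_gen
      by (intro disjI2 conjI) (auto intro: finite_subset[OF _ F(1)])
    ultimately show ?thesis
      by simp
  qed
  have topD: "D \<subseteq> topspace P"
    by (auto simp: D_def e_def topP)
  have DK: "D \<subseteq> K"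
    unfolding K_def by (rule closure_of_subset[OF topD])
  have KP: "K \<subseteq> topspace P"
    unfolding K_def by (rule closure_of_subset_topspace)
  have topY: "topspace Y = K"
    using KP by (auto simp: Y_def)
  have cont: "continuous_map X (subtopology P D) e"
  proof -
    have comp: "continuous_map X (discrete_topology UNIV) (\<lambda>x. x \<in> B)" if "B \<in> \<B>" for B
    proof -
      have B: "openin X B" "openin X (topspace X - B)" "B \<subseteq> topspace X"
        using scattered_subbase_clopenin[OF \<B> that] openin_subset by auto
      have "openin X {x \<in> topspace X. (x \<in> B) \<in> V}" for V
      proof -
        have "{x \<in> topspace X. (x \<in> B) \<in> V} =
            (if True \<in> V then B else {}) \<union> (if False \<in> V then topspace X - B else {})"
          using B(3) by auto (metis (full_types))+
        then show ?thesis
          using B by (simp add: openin_Un del: Un_Diff_cancel)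
      qed
      then show ?thesis
        by (simp add: continuous_map)
    qed
    have "continuous_map X P e"
      unfolding P_def continuous_map_componentwise
    proof (intro conjI ballI)
      show "e ` topspace X \<subseteq> extensional \<B>"
        by (auto simp: e_def)
      show "continuous_map X (discrete_topology UNIV) (\<lambda>x. e x B)" if "B \<in> \<B>" for B
        using comp[OF that] that by (simp add: e_def)
    qed
    then show ?thesis
      by (auto simp: continuous_map_in_subtopology D_def)
  qed
  have e_sep: "\<exists>F. finite F \<and> F \<subseteq> \<B> \<and> (\<forall>y\<in>topspace X. e y \<in> box F (e x) \<longrightarrow> y \<in> W)"
    if W: "openin X W" "x \<in> W" for x W
  proof -
    have "x \<in> topspace X"
      using W openin_subset by blast
    then obtain F where F: "finite F" "F \<subseteq> \<B>"
      "\<forall>y\<in>topspace X. (\<forall>B\<in>F. y \<in> B \<longleftrightarrow> x \<in> B) \<longrightarrow> y \<in> W"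
      using scattered_subbase_separates[OF \<B> W] by blast
    have "y \<in> W" if "y \<in> topspace X" "e y \<in> box F (e x)" for y
    proof -
      have "e y B = e x B" if "B \<in> F" for B
        using \<open>e y \<in> _\<close> that by (simp add: box_def)
      then have "\<forall>B\<in>F. y \<in> B \<longleftrightarrow> x \<in> B"
        using F(2) by (metis e_def restrict_apply' subsetD)
      then show ?thesis
        using F(3) that(1) by blast
    qed
    then show ?thesis
      using F(1,2) by blast
  qed
  have inj: "inj_on e (topspace X)"
  proof (rule inj_onI, rule ccontr)
    fix x y assume xy: "x \<in> topspace X" "y \<in> topspace X" "e x = e y" "x \<noteq> y"
    have "openin X (topspace X - {y})" "x \<in> topspace X - {y}"
      using t1_space_openin_delete_point[OF t1] xy by auto
    from e_sep[OF this] obtain F where "e y \<in> box F (e x) \<longrightarrow> y \<in> topspace X - {y}"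
      using xy(2) by blast
    moreover have "e y \<in> box F (e x)"
      using xy topD by (auto simp: box_def D_def)
    ultimately show False
      by blast
  qed
  have "open_map X (subtopology P D) e"
    unfolding open_map_def
  proof (intro allI impI)
    fix W assume W: "openin X W"
    show "openin (subtopology P D) (e ` W)"
    proof (subst openin_subopen, rule ballI)
      fix f assume "f \<in> e ` W"
      then obtain x where x: "x \<in> W" "f = e x"
        by blast
      obtain F where F: "finite F" "F \<subseteq> \<B>" "\<forall>y\<in>topspace X. e y \<in> box F (e x) \<longrightarrow> y \<in> W"
        using e_sep[OF W x(1)] by blast
      have "e x \<in> D"
        using x(1) W openin_subset by (fastforce simp: D_def)
      have "openin (subtopology P D) (box F (e x) \<inter> D)"
        using open_box[OF F(1,2)] by (simp add: openin_subtopology_Int)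
      moreover have "f \<in> box F (e x) \<inter> D"
        using \<open>e x \<in> D\<close> x(2) topD by (auto simp: box_def)
      moreover have "box F (e x) \<inter> D \<subseteq> e ` W"
        using F(3) unfolding D_def by blast
      ultimately show "\<exists>T. openin (subtopology P D) T \<and> f \<in> T \<and> T \<subseteq> e ` W"
        by blast
    qed
  qed
  then have "homeomorphic_map X (subtopology P D) e"
    using cont inj topD
    by (intro bijective_open_imp_homeomorphic_map) (auto simp: D_def)
  moreover have "subtopology P D = subtopology Y D"
    using DK by (simp add: Y_def subtopology_subtopology Int_absorb1)
  ultimately have homeo: "X homeomorphic_space subtopology Y D"
    using homeomorphic_map_imp_homeomorphic_space by metis
  have "compact_space P" "Hausdorff_space P"
    by (auto simp: P_def compact_space_product_topology Hausdorff_space_product_topology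
        compact_space_discrete_topology)
  then have "compact_space Y" "Hausdorff_space Y"
    by (auto simp: Y_def K_def Hausdorff_space_subtopology closedin_compact_space
        compact_space_subtopology)
  moreover have "Y closure_of D = topspace Y"
    using DK by (simp add: topY) (simp add: Y_def closure_of_subtopology K_def Int_absorb1)
  ultimately have compactification: "compactification_of Y X"
    unfolding compactification_of_def using homeo DK topY by blast
  define \<tau> where "\<tau> = (\<lambda>f. {B \<in> \<B>. f B})"
  have \<tau>_traces: "\<tau> ` K \<subseteq> traces (topspace X) \<B>"
  proof (rule image_subsetI)
    fix f assume f: "f \<in> K"
    show "\<tau> f \<in> traces (topspace X) \<B>"
      unfolding traces_def
    proof (intro CollectI conjI allI impI)
      fix F assume F: "finite F \<and> F \<subseteq> \<B>"
      have "f \<in> box F f"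
        using f KP by (auto simp: box_def)
      then obtain x where "x \<in> topspace X" "e x \<in> box F f"
        using f open_box F unfolding K_def in_closure_of D_def by blast
      moreover have "B \<in> \<tau> f \<longleftrightarrow> x \<in> B" if "B \<in> F" for B
      proof -
        have "B \<in> \<B>" "e x B = f B"
          using that F \<open>e x \<in> box F f\<close> by (auto simp: box_def)
        then show ?thesis
          by (simp add: \<tau>_def e_def)
      qed
      ultimately show "\<exists>x\<in>topspace X. \<forall>B\<in>F. B \<in> \<tau> f \<longleftrightarrow> x \<in> B"
        by blast
    qed (auto simp: \<tau>_def)
  qed
  have \<tau>_inj: "inj_on \<tau> K"
  proof (rule inj_onI)
    fix f g assume fg: "f \<in> K" "g \<in> K" "\<tau> f = \<tau> g"
    then have "f \<in> extensional \<B>" "g \<in> extensional \<B>"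
      using KP topP by auto
    then show "f = g"
      by (rule extensionalityI) (use fg(3) in \<open>auto simp: \<tau>_def\<close>)
  qed
  have "scattered_space Y"
    unfolding scattered_space_def topY
  proof (intro allI impI)
    fix S assume S: "S \<subseteq> K \<and> S \<noteq> {}"
    then have S': "\<tau> ` S \<subseteq> traces (topspace X) \<B>" "\<tau> ` S \<noteq> {}"
      using \<tau>_traces by auto
    obtain t F where t: "t \<in> \<tau> ` S" and F: "finite F"
      and iso: "\<And>s. s \<in> \<tau> ` S \<Longrightarrow> s \<inter> F = t \<inter> F \<Longrightarrow> s = t"
      by (rule scattered_setsE[OF scattered_subbase_traces[OF \<B>] S']) (rule that; assumption)
    obtain f where f: "f \<in> S" "t = \<tau> f"
      using t by blast
    have "g = f" if g: "g \<in> S" "g \<in> box (F \<inter> \<B>) f" for g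
    proof -
      have "\<tau> g \<inter> F = t \<inter> F"
        using g(2) by (auto simp: f(2) \<tau>_def box_def)
      then have "\<tau> g = \<tau> f"
        using iso g(1) f(2) by blast
      then show ?thesis
        using \<tau>_inj S g(1) f(1) by (meson inj_onD subsetD)
    qed
    moreover have "f \<in> box (F \<inter> \<B>) f"
      using f S KP by (auto simp: box_def)
    ultimately have "{f} = box (F \<inter> \<B>) f \<inter> (K \<inter> S)"
      using f(1) S by auto
    moreover have "openin P (box (F \<inter> \<B>) f)"
      using F by (intro open_box) auto
    ultimately have "openin (subtopology Y S) {f}"
      unfolding Y_def subtopology_subtopology openin_subtopology by blast
    then show "\<exists>f\<in>S. openin (subtopology Y S) {f}"
      using f(1) by blast
  qed
  moreover have "|topspace Y| \<le>o omega1"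
  proof -
    have "|K| \<le>o |traces (topspace X) \<B>|"
      by (rule card_of_ordLeqI[OF \<tau>_inj]) (use \<tau>_traces in blast)
    moreover have "|traces (topspace X) \<B>| \<le>o omega1"
      by (rule card_scattered_sets[OF scattered_subbase_traces[OF \<B>] _ scattered_subbase_card[OF \<B>]])
        (rule traces_subset)
    ultimately show ?thesis
      unfolding topY using ordLeq_transitive by blast
  qed
  ultimately show ?thesis
    using compactification by blast
qed

section \<open>Cardinality and change of carrier\<close>

text \<open>
  Otherwise \<open>X\<close> would be countable, the complement of each point would be a countable union
  of closed sets, and the singletons would form a countable base.
\<close>

lemma omega1_le_card_topspace:
  assumes t1: "t1_space X" and P: "P_space X" and w: "has_weight X omega1"
  shows "omega1 \<le>o |topspace X|"
proof (rule ccontr)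
  assume "\<not> omega1 \<le>o |topspace X|"
  then have "|topspace X| <o omega1"
    using not_ordLeq_iff_ordLess[OF card_of_Well_order card_order_on_well_order_on[OF Card_order_omega1]]
    by blast
  then have cnt: "countable (topspace X)"
    using countable_iff_ordLess_omega1 by blast
  have discrete: "openin X {x}" if x: "x \<in> topspace X" for x
  proof -
    have "openin X (topspace X \<inter> \<Inter>((\<lambda>y. topspace X - {y}) ` (topspace X - {x})))"
      by (rule P_space_openin_countable_Inter[OF P])
        (use t1_space_openin_delete_point[OF t1] cnt in auto)
    moreover have "topspace X \<inter> \<Inter>((\<lambda>y. topspace X - {y}) ` (topspace X - {x})) = {x}"
      using x by auto
    ultimately show ?thesis
      by simp
  qed
  have "base_of X ((\<lambda>x. {x}) ` topspace X)"
    unfolding base_of_def using discrete openin_subset by fastforce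
  then have "omega1 \<le>o |(\<lambda>x. {x}) ` topspace X|"
    using w unfolding has_weight_def by blast
  then show False
    using \<open>\<not> omega1 \<le>o |topspace X|\<close> card_of_image ordLeq_transitive by blast
qed

lemma card_compactification_ge:
  assumes "compactification_of Y X"
  shows "|topspace X| \<le>o |topspace Y|"
proof -
  obtain D f where D: "D \<subseteq> topspace Y" "homeomorphic_map X (subtopology Y D) f"
    using assms unfolding compactification_of_def homeomorphic_space by blast
  have "inj_on f (topspace X)" "f ` topspace X \<subseteq> topspace Y"
    using D by (auto simp: homeomorphic_eq_everything_map)
  then show ?thesis
    using card_of_ordLeqI[of f] by blast
qed

lemma homeomorphic_space_on_type:
  fixes Y :: "'a topology"
  assumes "|topspace Y| \<le>o |UNIV :: 'b set|"
  obtains Z :: "'b topology" and h where "homeomorphic_map Y Z h"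
proof -
  obtain h :: "'a \<Rightarrow> 'b" where h: "inj_on h (topspace Y)"
    using assms unfolding card_of_ordLeq[symmetric] by blast
  define g where "g = inv_into (topspace Y) h"
  define Z where "Z = pullback_topology (h ` topspace Y) g Y"
  have gh: "g (h y) = y" if "y \<in> topspace Y" for y
    using h that by (simp add: g_def)
  have topZ: "topspace Z = h ` topspace Y"
    by (auto simp: Z_def topspace_pullback_topology gh)
  have "homeomorphic_map Y Z h"
  proof (rule bijective_open_imp_homeomorphic_map)
    show "continuous_map Y Z h"
      unfolding continuous_map
    proof (intro conjI allI impI)
      fix V assume "openin Z V"
      then obtain U where U: "openin Y U" "V = g -` U \<inter> h ` topspace Y"
        unfolding Z_def openin_pullback_topology by blast
      then have "{y \<in> topspace Y. h y \<in> V} = U"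
        using openin_subset[OF U(1)] gh by force
      then show "openin Y {y \<in> topspace Y. h y \<in> V}"
        using U(1) by simp
    qed (simp add: topZ)
    show "open_map Y Z h"
      unfolding open_map_def
    proof (intro allI impI)
      fix U assume U: "openin Y U"
      then have "h ` U = g -` U \<inter> h ` topspace Y"
        using openin_subset[OF U] by (auto simp: gh)
      then show "openin Z (h ` U)"
        unfolding Z_def openin_pullback_topology using U by blast
    qed
  qed (use topZ h in auto)
  then show thesis
    by (rule that)
qed

lemma homeomorphic_compactification_of:
  assumes h: "homeomorphic_map Y Z h" and Y: "compactification_of Y X"
  shows "compactification_of Z X"
proof -
  obtain D where D: "D \<subseteq> topspace Y" "X homeomorphic_space subtopology Y D"
    "Y closure_of D = topspace Y"
    using Y unfolding compactification_of_def by blast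
  have YZ: "Y homeomorphic_space Z"
    using h homeomorphic_map_imp_homeomorphic_space by blast
  then have "compact_space Z" "Hausdorff_space Z"
    using Y homeomorphic_compact_space[OF YZ] homeomorphic_Hausdorff_space[OF YZ]
    by (simp_all add: compactification_of_def)
  moreover have surj: "h ` topspace Y = topspace Z"
    using h by (rule homeomorphic_imp_surjective_map)
  then have "h ` D \<subseteq> topspace Z"
    using D(1) by blast
  moreover have "subtopology Y D homeomorphic_space subtopology Z (h ` D)"
    using D(1) \<open>h ` D \<subseteq> topspace Z\<close>
    by (intro homeomorphic_map_imp_homeomorphic_space[OF homeomorphic_map_subtopologies[OF h]])
      (simp add: Int_absorb1)
  then have "X homeomorphic_space subtopology Z (h ` D)"
    using D(2) homeomorphic_space_trans by blast
  moreover have "Z closure_of (h ` D) = topspace Z"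
    using homeomorphic_map_closure_of[OF h D(1)] D(3) surj by simp
  ultimately show ?thesis
    unfolding compactification_of_def by blast
qed

lemma homeomorphic_scattered_space:
  assumes h: "homeomorphic_map Y Z h" and Y: "scattered_space Y"
  shows "scattered_space Z"
  unfolding scattered_space_def
proof (intro allI impI)
  fix S assume S: "S \<subseteq> topspace Z \<and> S \<noteq> {}"
  define T where "T = {y \<in> topspace Y. h y \<in> S}"
  have surj: "h ` topspace Y = topspace Z" and "open_map Y Z h"
    using h by (auto simp: homeomorphic_eq_everything_map)
  have "S \<subseteq> h ` topspace Y"
    using S surj by simp
  then have "T \<subseteq> topspace Y" "T \<noteq> {}"
    using S unfolding T_def by fastforce+
  then have "\<exists>y\<in>T. openin (subtopology Y T) {y}"
    using Y[unfolded scattered_space_def, rule_format, of T] by blast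
  then obtain y where y: "y \<in> T" "openin (subtopology Y T) {y}"
    by blast
  then obtain V where V: "openin Y V" "{y} = V \<inter> T"
    unfolding openin_subtopology by blast
  have "openin Z (h ` V)"
    using \<open>open_map Y Z h\<close> V(1) unfolding open_map_def by blast
  moreover have "h ` V \<inter> S = h ` (V \<inter> T)"
    using openin_subset[OF V(1)] by (auto simp: T_def)
  then have "{h y} = h ` V \<inter> S"
    by (simp add: V(2)[symmetric])
  ultimately have "openin (subtopology Z S) {h y}"
    unfolding openin_subtopology by blast
  then show "\<exists>z\<in>S. openin (subtopology Z S) {z}"
    using y(1) unfolding T_def by blast
qed

theorem corollary7:
  fixes X :: "'a topology"
  assumes "regular_space X" and "t1_space X"
    and "scattered_space X"
    and "P_space X"
    and "has_weight X omega1"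
  shows "\<exists>Y :: nat set topology.
    compactification_of Y X \<and> scattered_space Y \<and> |topspace Y| =o omega1"
proof -
  obtain \<B> where "scattered_subbase X (topspace X) \<B>"
    using tame_topspace[OF assms] unfolding tame_def by blast
  then obtain K :: "('a set \<Rightarrow> bool) topology"
    where K: "compactification_of K X" "scattered_space K" "|topspace K| \<le>o omega1"
    using scattered_subbase_compactification[OF assms(2)] by blast
  obtain Y :: "nat set topology" and h where h: "homeomorphic_map K Y h"
    by (rule homeomorphic_space_on_type[OF ordLeq_transitive[OF K(3) omega1_le_UNIV_nat_set]])
  have Y: "compactification_of Y X"
    by (rule homeomorphic_compactification_of[OF h K(1)])
  have "topspace Y = h ` topspace K"
    using homeomorphic_imp_surjective_map[OF h] by simp
  then have "|topspace Y| \<le>o omega1"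
    using image_ordLeq_omega1[OF K(3)] by simp
  moreover have "omega1 \<le>o |topspace Y|"
    using omega1_le_card_topspace[OF assms(2,4,5)] card_compactification_ge[OF Y]
      ordLeq_transitive by blast
  ultimately have "|topspace Y| =o omega1"
    by (simp add: ordIso_iff_ordLeq)
  then show ?thesis
    using Y homeomorphic_scattered_space[OF h K(2)] by blast
qed

end
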